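(* Let $\mathcal{H}$ be a complex Hilbert space of dimension $d\ge 2$ with orthonormal bases $\mathcal{A}=\{|a_i\rangle\}_{i=0}^{d-1}$ and $\mathcal{B}=\{|b_j\rangle\}_{j=0}^{d-1}$ whose transition matrix is the discrete Fourier transform matrix, i.e. $\langle a_i|b_j\rangle=\frac{1}{\sqrt d}\,\omega_d^{ij}$ for all $i,j\in\{0,\dots,d-1\}$, where $\omega_d=e^{2\pi\sqrt{-1}/d}$. Let $n$ be an integer with $0\le n\le d$. Then the point $(d-n,2)$ belongs to $\mathrm{UNCD}(\mathcal{A},\mathcal{B})$ if and only if either $n=0$, or $n\mid d$ and $n\neq d$.
   Context: A state is a unit vector $|\psi\rangle\in\mathcal{H}$. Its support sizes are $n_{\mathcal{A}}(\psi)=|\{i:\langle a_i|\psi\rangle\neq 0\}|$ and $n_{\mathcal{B}}(\psi)=|\{j:\langle b_j|\psi\rangle\neq 0\}|$. The uncertainty diagram $\mathrm{UNCD}(\mathcal{A},\mathcal{B})$ is the set of pairs $(n_{\mathcal{A}},n_{\mathcal{B}})\in\{1,\dots,d\}\times\{1,\dots,d\}$ for which there exists a state $|\psi\rangle$ with $n_{\mathcal{A}}(\psi)=n_{\mathcal{A}}$ and $n_{\mathcal{B}}(\psi)=n_{\mathcal{B}}$. *)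

theory Defs
  imports "HOL-Analysis.Analysis"
begin

text \<open>Inner products are conjugate-linear in the first and linear in the second argument,
  as in Dirac notation.\<close>

definition ip_norm :: "('h \<Rightarrow> 'h \<Rightarrow> complex) \<Rightarrow> 'h \<Rightarrow> real" where
  "ip_norm ip x = sqrt (Re (ip x x))"

locale complex_inner_product_space = vector_space scl
  for scl :: "complex \<Rightarrow> 'h::ab_group_add \<Rightarrow> 'h" +
  fixes ip :: "'h \<Rightarrow> 'h \<Rightarrow> complex"
  assumes ip_cnj: "ip y x = cnj (ip x y)"
    and ip_add_right: "ip x (y + z) = ip x y + ip x z"
    and ip_scale_right: "ip x (scl c y) = c * ip x y"
    and ip_pos: "x \<noteq> 0 \<Longrightarrow> 0 < Re (ip x x)"
begin

lemma ip_zero_right [simp]: "ip x 0 = 0"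
  using ip_add_right[of x 0 0] by simp

lemma ip_zero_left [simp]: "ip 0 x = 0"
  using ip_cnj[of 0 x] by simp

lemma ip_add_left: "ip (x + y) z = ip x z + ip y z"
  using ip_cnj[of "x + y" z] ip_cnj[of x z] ip_cnj[of y z] by (simp add: ip_add_right)

lemma ip_scale_left: "ip (scl c x) y = cnj c * ip x y"
  using ip_cnj[of "scl c x" y] ip_cnj[of x y] by (simp add: ip_scale_right)

lemma ip_self_nonneg: "0 \<le> Re (ip x x)"
  using ip_pos[of x] by (cases "x = 0") auto

lemma ip_norm_eq_0_iff: "ip_norm ip x = 0 \<longleftrightarrow> x = 0"
  using ip_pos[of x] by (cases "x = 0") (auto simp: ip_norm_def)

lemma ip_norm_minus: "ip_norm ip (- x) = ip_norm ip x"
proof -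
  have "- x = scl (-1) x" by simp
  then show ?thesis
    unfolding ip_norm_def by (simp only: ip_scale_left ip_scale_right) simp
qed

lemma Re_ip_le: "Re (ip x y) \<le> ip_norm ip x * ip_norm ip y"
proof (cases "x = 0 \<or> y = 0")
  case True
  then show ?thesis by (auto simp: ip_norm_def)
next
  case False
  define p q where "p = ip_norm ip x" and "q = ip_norm ip y"
  have pq: "p > 0" "q > 0" "Re (ip x x) = p\<^sup>2" "Re (ip y y) = q\<^sup>2"
    using False ip_pos[of x] ip_pos[of y] by (auto simp: p_def q_def ip_norm_def)
  have sym: "Re (ip y x) = Re (ip x y)"
    by (subst ip_cnj) simp
  define z where "z = scl (of_real q) x + scl (of_real (- p)) y"
  have "0 \<le> Re (ip z z)" by (rule ip_self_nonneg)
  also have "Re (ip z z) = q * q * p\<^sup>2 + p * p * q\<^sup>2 - 2 * (p * q) * Re (ip x y)"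
    unfolding z_def ip_add_left ip_add_right ip_scale_left ip_scale_right
    by (simp add: pq sym algebra_simps)
  finally have "(p * q) * Re (ip x y) \<le> (p * q) * (p * q)"
    by (simp add: power2_eq_square algebra_simps)
  then have "Re (ip x y) \<le> p * q"
    using pq by simp
  then show ?thesis by (simp add: p_def q_def)
qed

lemma ip_norm_triangle: "ip_norm ip (x + y) \<le> ip_norm ip x + ip_norm ip y"
proof -
  have sym: "Re (ip y x) = Re (ip x y)"
    by (subst ip_cnj) simp
  have nn: "0 \<le> ip_norm ip x" "0 \<le> ip_norm ip y"
    by (auto simp: ip_norm_def ip_self_nonneg)
  have "Re (ip (x + y) (x + y)) = (ip_norm ip x)\<^sup>2 + (ip_norm ip y)\<^sup>2 + 2 * Re (ip x y)"
    by (simp add: ip_add_left ip_add_right sym ip_norm_def ip_self_nonneg)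
  also have "\<dots> \<le> (ip_norm ip x + ip_norm ip y)\<^sup>2"
    using Re_ip_le[of x y] by (simp add: power2_sum)
  finally show ?thesis
    using nn unfolding ip_norm_def[of ip "x + y"] by (simp add: real_le_lsqrt ip_self_nonneg)
qed

sublocale metric: Metric_space UNIV "\<lambda>x y. ip_norm ip (x - y)"
proof
  show "0 \<le> ip_norm ip (x - y)" for x y
    by (simp add: ip_norm_def ip_self_nonneg)
  show "ip_norm ip (x - y) = ip_norm ip (y - x)" for x y
    using ip_norm_minus[of "x - y"] by simp
  show "ip_norm ip (x - y) = 0 \<longleftrightarrow> x = y" for x y
    by (simp add: ip_norm_eq_0_iff)
  show "ip_norm ip (x - z) \<le> ip_norm ip (x - y) + ip_norm ip (y - z)" for x y z
    using ip_norm_triangle[of "x - y" "y - z"] by simp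
qed

end

locale complex_Hilbert_space = complex_inner_product_space +
  assumes complete: "metric.mcomplete"

text \<open>Only the values of the family \<open>e\<close> at indices below \<open>d\<close> matter.\<close>

definition is_orthonormal_basis ::
    "(complex \<Rightarrow> 'h::ab_group_add \<Rightarrow> 'h) \<Rightarrow> ('h \<Rightarrow> 'h \<Rightarrow> complex) \<Rightarrow> nat \<Rightarrow> (nat \<Rightarrow> 'h) \<Rightarrow> bool" where
  "is_orthonormal_basis scl ip d e \<longleftrightarrow>
     (\<forall>i<d. \<forall>j<d. ip (e i) (e j) = (if i = j then 1 else 0)) \<and>
     module.span scl (e ` {..<d}) = UNIV"

definition is_state :: "('h \<Rightarrow> 'h \<Rightarrow> complex) \<Rightarrow> 'h \<Rightarrow> bool" where
  "is_state ip \<psi> \<longleftrightarrow> ip_norm ip \<psi> = 1"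

definition supp_size :: "('h \<Rightarrow> 'h \<Rightarrow> complex) \<Rightarrow> nat \<Rightarrow> (nat \<Rightarrow> 'h) \<Rightarrow> 'h \<Rightarrow> nat" where
  "supp_size ip d e \<psi> = card {i. i < d \<and> ip (e i) \<psi> \<noteq> 0}"

definition UNCD :: "('h \<Rightarrow> 'h \<Rightarrow> complex) \<Rightarrow> nat \<Rightarrow> (nat \<Rightarrow> 'h) \<Rightarrow> (nat \<Rightarrow> 'h) \<Rightarrow> (nat \<times> nat) set" where
  "UNCD ip d a b =
     {(nA, nB). nA \<in> {1..d} \<and> nB \<in> {1..d} \<and>
        (\<exists>\<psi>. is_state ip \<psi> \<and> supp_size ip d a \<psi> = nA \<and> supp_size ip d b \<psi> = nB)}"

definition root_of_unity :: "nat \<Rightarrow> complex" where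
  "root_of_unity d = exp (2 * of_real pi * \<i> / of_nat d)"

end

theory Submission
  imports Defs "HOL-Number_Theory.Cong"
begin

text \<open>A state supported on two vectors \<open>b j\<close>, \<open>b k\<close> with \<open>j < k\<close> has the coefficients
  \<open>\<omega> ^ (i * j) * (\<alpha> + \<beta> * \<omega> ^ (i * (k - j))) / sqrt d\<close> in the basis \<open>a\<close>. These vanish exactly
  when \<open>\<omega> ^ (i * (k - j)) = - \<alpha> / \<beta>\<close>, which has either no solution modulo \<open>d\<close> or a full coset
  of \<open>gcd (k - j) d\<close> solutions; every proper divisor \<open>n\<close> of \<open>d\<close> occurs, with \<open>k - j = n\<close>.\<close>

lemma root_of_unity_power_eq_iff:
  assumes "d > 0"
  shows "root_of_unity d ^ p = root_of_unity d ^ q \<longleftrightarrow> [p = q] (mod d)"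
proof -
  have "root_of_unity d ^ p = exp (2 * of_real pi * \<i> * of_nat p / of_nat d)" for p
    unfolding root_of_unity_def exp_of_nat_mult[symmetric] by (simp add: mult_ac)
  then show ?thesis
    using complex_root_unity_eq[of d p q] assms by (simp add: cong_def)
qed

text \<open>With \<open>g = gcd m d\<close>, the factor \<open>m div g\<close> is coprime to
  \<open>d div g\<close>. Removing \<open>g\<close> from both sides and from the modulus therefore
  leaves a factor that can be cancelled.\<close>

lemma cong_mult_right_iff_gcd:
  fixes d m p q :: nat
  assumes "d > 0"
  shows "[p * m = q * m] (mod d) \<longleftrightarrow> [p = q] (mod d div gcd m d)"
proof -
  define g where "g = gcd m d"
  have "g > 0" using assms by (simp add: g_def)
  then obtain m' e where me: "m = m' * g" "d = e * g" "coprime m' e"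
    using gcd_coprime_exists[of m d] unfolding g_def by blast
  \<comment> \<open>Here \<open>mult_mod_left\<close> pulls the common factor \<open>g\<close> out
    of both remainders, and \<open>g > 0\<close> cancels it.\<close>
  have "[p * m = q * m] (mod d) \<longleftrightarrow> [p * m' = q * m'] (mod e)"
    unfolding me(1,2) cong_def mult.assoc[symmetric] mult_mod_left[symmetric]
    using \<open>g > 0\<close> by simp
  also have "\<dots> \<longleftrightarrow> [p = q] (mod e)"
    using me by (simp add: cong_mult_rcancel_nat)
  finally show ?thesis
    using me(2) \<open>g > 0\<close> unfolding g_def[symmetric] by simp
qed

text \<open>The range below \<open>g * e\<close> consists of \<open>g\<close> full periods of length
  \<open>e\<close>, and each period meets a residue class exactly once.\<close>

lemma card_cong_less_mult:
  fixes e g q :: nat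
  assumes "e > 0"
  shows "card {p. p < g * e \<and> [p = q] (mod e)} = g"
proof -
  have "{p. p < g * e \<and> [p = q] (mod e)} = (\<lambda>t. q mod e + t * e) ` {..<g}"
  proof (intro equalityI subsetI)
    fix p assume p: "p \<in> {p. p < g * e \<and> [p = q] (mod e)}"
    then have "p = q mod e + (p div e) * e"
      by (simp add: cong_def) (metis mod_div_mult_eq)
    moreover have "p div e < g"
      using p assms by (simp add: less_mult_imp_div_less)
    ultimately show "p \<in> (\<lambda>t. q mod e + t * e) ` {..<g}" by blast
  next
    fix p assume "p \<in> (\<lambda>t. q mod e + t * e) ` {..<g}"
    then obtain t where t: "t < g" "p = q mod e + t * e" by auto
    \<comment> \<open>The remainder is below \<open>e\<close>, so \<open>p\<close> stays below
      \<open>Suc t * e\<close>, and \<open>Suc t \<le> g\<close>.\<close>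
    have "p < e + t * e" using t assms by simp
    also have "\<dots> \<le> g * e" using t mult_le_mono1[of "Suc t" g e] by simp
    finally show "p \<in> {p. p < g * e \<and> [p = q] (mod e)}"
      using t by (simp add: cong_def)
  qed
  moreover have "inj_on (\<lambda>t. q mod e + t * e) {..<g}"
    using assms by (auto simp: inj_on_def)
  ultimately show ?thesis by (simp add: card_image)
qed

text \<open>Equality of the powers is a congruence of \<open>i\<close> and \<open>q\<close> modulo
  \<open>d div gcd m d\<close>, and the range below \<open>d\<close> contains exactly
  \<open>gcd m d\<close> periods of that length.\<close>

lemma card_root_of_unity_power_eq:
  assumes "d > 0"
  shows "card {i. i < d \<and> root_of_unity d ^ (i * m) = root_of_unity d ^ (q * m)} = gcd m d"
proof -
  have "card {i. i < gcd m d * (d div gcd m d) \<and> [i = q] (mod d div gcd m d)} = gcd m d"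
    using assms by (intro card_cong_less_mult) (simp add: div_greater_zero_iff)
  then show ?thesis
    using assms by (simp add: root_of_unity_power_eq_iff cong_mult_right_iff_gcd)
qed

text \<open>A single zero \<open>q\<close> already expresses \<open>- \<alpha> / \<beta>\<close> as
  a power of the root of unity, so all zeros are then counted by
  \<open>card_root_of_unity_power_eq\<close>.\<close>

lemma card_zeros_two_term:
  assumes "j < k" "k < d" "\<alpha> \<noteq> 0" "\<beta> \<noteq> 0"
    and zeros: "Z = {i. i < d \<and> \<alpha> * root_of_unity d ^ (i * j) + \<beta> * root_of_unity d ^ (i * k) = 0}"
  shows "card Z = 0 \<or> card Z = gcd (k - j) d"
proof (cases "Z = {}")
  case False
  define \<omega> where "\<omega> = root_of_unity d"
  have "\<omega> \<noteq> 0" by (simp add: \<omega>_def root_of_unity_def)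
  have zero_iff: "\<alpha> * \<omega> ^ (i * j) + \<beta> * \<omega> ^ (i * k) = 0 \<longleftrightarrow> \<omega> ^ (i * (k - j)) = - \<alpha> / \<beta>" for i
  proof -
    \<comment> \<open>Factoring out the nonzero \<open>\<omega> ^ (i * j)\<close> leaves only the
      difference \<open>k - j\<close>; the subtraction is exact because
      \<open>j < k\<close>.\<close>
    have "i * k = i * j + i * (k - j)"
      using \<open>j < k\<close> by (simp flip: distrib_left)
    then have "\<alpha> * \<omega> ^ (i * j) + \<beta> * \<omega> ^ (i * k) = \<omega> ^ (i * j) * (\<alpha> + \<beta> * \<omega> ^ (i * (k - j)))"
      by (simp only: power_add distrib_left mult_ac)
    then have "\<alpha> * \<omega> ^ (i * j) + \<beta> * \<omega> ^ (i * k) = 0 \<longleftrightarrow> \<alpha> + \<beta> * \<omega> ^ (i * (k - j)) = 0"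
      using \<open>\<omega> \<noteq> 0\<close> by simp
    also have "\<dots> \<longleftrightarrow> \<omega> ^ (i * (k - j)) = - \<alpha> / \<beta>"
      using \<open>\<beta> \<noteq> 0\<close> by (simp add: eq_divide_eq eq_neg_iff_add_eq_0 ac_simps del: divide_minus_left)
    finally show ?thesis .
  qed
  obtain q where "q \<in> Z" using False by blast
  then have "Z = {i. i < d \<and> \<omega> ^ (i * (k - j)) = \<omega> ^ (q * (k - j))}"
    by (auto simp: zeros zero_iff simp flip: \<omega>_def)
  then show ?thesis
    using card_root_of_unity_power_eq[of d "k - j" q] assms by (simp add: \<omega>_def)
qed simp

text \<open>Both sides are linear in \<open>y\<close>, so it suffices to check basis vectors, where
  orthonormality collapses the sum to one term.\<close>

lemma (in complex_inner_product_space) ip_orthonormal_expansion: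
  assumes "is_orthonormal_basis scl ip d e"
  shows "ip x y = (\<Sum>j<d. ip (e j) y * ip x (e j))"
proof -
  have "y \<in> span (e ` {..<d})"
    using assms by (simp add: is_orthonormal_basis_def)
  then show ?thesis
  proof (induction rule: span_induct)
    case base
    show ?case
      by (auto simp: subspace_def ip_add_right ip_scale_right distrib_right sum.distrib
          sum_distrib_left mult.assoc)
  next
    case (step y)
    then obtain k where k: "k < d" "y = e k" by auto
    have "(\<Sum>j<d. ip (e j) y * ip x (e j)) = (\<Sum>j<d. if j = k then ip x (e k) else 0)"
      using assms k by (intro sum.cong) (auto simp: is_orthonormal_basis_def)
    then show ?case using k by simp
  qed
qed

lemma supp_size_eq_diff: "supp_size ip d e x = d - card {i. i < d \<and> ip (e i) x = 0}"
proof -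
  have "{i. i < d \<and> ip (e i) x \<noteq> 0} = {..<d} - {i. i < d \<and> ip (e i) x = 0}" by auto
  then show ?thesis
    unfolding supp_size_def by (simp add: card_Diff_subset subset_iff)
qed

text \<open>Supplies the witnesses for membership in the diagram: by orthonormality the cross terms
  vanish and the squared norm is the sum of the squared moduli.\<close>

lemma (in complex_inner_product_space) two_term_state:
  assumes b: "is_orthonormal_basis scl ip d b" and jk: "j < d" "k < d" "j \<noteq> k"
    and \<alpha>\<beta>: "\<alpha> \<noteq> 0" "\<beta> \<noteq> 0" "(cmod \<alpha>)\<^sup>2 + (cmod \<beta>)\<^sup>2 = 1"
  shows "is_state ip (scl \<alpha> (b j) + scl \<beta> (b k))"
    and "supp_size ip d b (scl \<alpha> (b j) + scl \<beta> (b k)) = 2"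
proof -
  define \<psi> where "\<psi> = scl \<alpha> (b j) + scl \<beta> (b k)"
  have orth: "ip (b i) (b l) = (if i = l then 1 else 0)" if "i < d" "l < d" for i l
    using b that by (simp add: is_orthonormal_basis_def)
  have coeff: "ip (b i) \<psi> = (if i = j then \<alpha> else if i = k then \<beta> else 0)" if "i < d" for i
    using jk that by (simp add: \<psi>_def ip_add_right ip_scale_right orth)
  have "{i. i < d \<and> ip (b i) \<psi> \<noteq> 0} = {j, k}"
    using jk \<alpha>\<beta> by (auto simp: coeff split: if_splits)
  then show "supp_size ip d b (scl \<alpha> (b j) + scl \<beta> (b k)) = 2"
    using jk by (simp add: supp_size_def flip: \<psi>_def)
  have "ip \<psi> \<psi> = \<alpha> * cnj \<alpha> + \<beta> * cnj \<beta>"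
    using jk unfolding \<psi>_def
    by (simp add: ip_add_right ip_scale_right ip_add_left ip_scale_left orth)
  then have "ip \<psi> \<psi> = of_real ((cmod \<alpha>)\<^sup>2 + (cmod \<beta>)\<^sup>2)"
    by (simp only: complex_norm_square of_real_add)
  then show "is_state ip (scl \<alpha> (b j) + scl \<beta> (b k))"
    using \<alpha>\<beta> by (simp add: is_state_def ip_norm_def flip: \<psi>_def)
qed

theorem theorem2:
  fixes scl :: "complex \<Rightarrow> 'h::ab_group_add \<Rightarrow> 'h"
    and ip :: "'h \<Rightarrow> 'h \<Rightarrow> complex"
    and a b :: "nat \<Rightarrow> 'h"
    and d n :: nat
  assumes "complex_Hilbert_space scl ip"
    and "vector_space.dim scl (UNIV :: 'h set) = d"
    and "d \<ge> 2"
    and "is_orthonormal_basis scl ip d a"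
    and "is_orthonormal_basis scl ip d b"
    and "\<forall>i<d. \<forall>j<d. ip (a i) (b j) = 1 / of_real (sqrt (real d)) * root_of_unity d ^ (i * j)"
    and "n \<le> d"
  shows "(d - n, 2) \<in> UNCD ip d a b \<longleftrightarrow> n = 0 \<or> (n dvd d \<and> n \<noteq> d)"
proof
  interpret complex_Hilbert_space scl ip by fact
  have trans: "ip (a i) (b j) = 1 / of_real (sqrt (real d)) * root_of_unity d ^ (i * j)"
    if "i < d" "j < d" for i j
    using assms(6) that by blast
  {
    assume "(d - n, 2) \<in> UNCD ip d a b"
    then obtain \<psi> where nd: "d - n \<ge> 1" and sa: "supp_size ip d a \<psi> = d - n"
      and sb: "supp_size ip d b \<psi> = 2"
      by (auto simp: UNCD_def)
    from sb obtain j' k' where "{j. j < d \<and> ip (b j) \<psi> \<noteq> 0} = {j', k'}" "j' \<noteq> k'"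
      unfolding supp_size_def card_2_iff by blast
    \<comment> \<open>The two indices are named in increasing order, as
      \<open>card_zeros_two_term\<close> requires.\<close>
    then obtain j k where supp: "{j. j < d \<and> ip (b j) \<psi> \<noteq> 0} = {j, k}" and "j < k"
      by (metis insert_commute nat_neq_iff)
    then have jk: "j < d" "k < d" and ne: "ip (b j) \<psi> \<noteq> 0" "ip (b k) \<psi> \<noteq> 0" by blast+
    have "ip (a i) \<psi> = 0 \<longleftrightarrow> ip (b j) \<psi> * root_of_unity d ^ (i * j)
        + ip (b k) \<psi> * root_of_unity d ^ (i * k) = 0" if "i < d" for i
    proof -
      have "ip (a i) \<psi> = (\<Sum>l<d. ip (b l) \<psi> * ip (a i) (b l))"
        by (rule ip_orthonormal_expansion) fact
      also have "\<dots> = (\<Sum>l\<in>{j, k}. ip (b l) \<psi> * ip (a i) (b l))"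
        using supp by (intro sum.mono_neutral_right) auto
      also have "\<dots> = (ip (b j) \<psi> * root_of_unity d ^ (i * j)
          + ip (b k) \<psi> * root_of_unity d ^ (i * k)) / of_real (sqrt (real d))"
        using \<open>j < k\<close> jk that by (simp add: trans add_divide_distrib)
      finally show ?thesis using \<open>d \<ge> 2\<close> by simp
    qed
    then have Z: "{i. i < d \<and> ip (a i) \<psi> = 0} = {i. i < d \<and> ip (b j) \<psi> * root_of_unity d ^ (i * j)
        + ip (b k) \<psi> * root_of_unity d ^ (i * k) = 0}"
      by blast
    \<comment> \<open>Both this cardinality and \<open>n\<close> are at most \<open>d\<close>, so
      equality of the truncated differences from \<open>d\<close> yields equality of the
      two.\<close>
    have "card {i. i < d \<and> ip (a i) \<psi> = 0} \<le> card {..<d}"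
      by (intro card_mono) auto
    then have "n = card {i. i < d \<and> ip (a i) \<psi> = 0}"
      using sa \<open>n \<le> d\<close> by (simp add: supp_size_eq_diff)
    \<comment> \<open>A nonzero \<open>n\<close> is \<open>gcd (k - j) d\<close>, hence a divisor of
      \<open>d\<close>; the bound \<open>d - n \<ge> 1\<close> excludes
      \<open>n = d\<close>.\<close>
    then show "n = 0 \<or> (n dvd d \<and> n \<noteq> d)"
      using card_zeros_two_term[OF \<open>j < k\<close> \<open>k < d\<close> ne Z] nd by auto
  }
  {
    assume n: "n = 0 \<or> (n dvd d \<and> n \<noteq> d)"
    \<comment> \<open>Taking the first index to be 0 turns its phase into 1, so only
      \<open>k\<close> and the two coefficients remain to be chosen.\<close>
    have "\<exists>k \<alpha> \<beta>. 0 < k \<and> k < d \<and> \<alpha> \<noteq> 0 \<and> \<beta> \<noteq> 0 \<and> (cmod \<alpha>)\<^sup>2 + (cmod \<beta>)\<^sup>2 = 1 \<and>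
        card {i. i < d \<and> \<alpha> + \<beta> * root_of_unity d ^ (i * k) = 0} = n"
    proof (cases "n = 0")
      case True
      \<comment> \<open>Coefficients of unequal modulus can never cancel against a phase; 3/5 and
        4/5 are such a pair with squares summing to 1.\<close>
      have "cmod (root_of_unity d) = 1"
        by (simp add: root_of_unity_def)
      then have "cmod (4/5 * root_of_unity d ^ (i * 1)) \<noteq> cmod (- (3/5))" for i
        by (simp add: norm_mult norm_power)
      then have "3/5 + 4/5 * root_of_unity d ^ (i * 1) \<noteq> 0" for i
        by (metis add_eq_0_iff)
      then have "card {i. i < d \<and> 3/5 + 4/5 * root_of_unity d ^ (i * 1) = 0} = n"
        using True by simp
      moreover have "(cmod (3/5))\<^sup>2 + (cmod (4/5))\<^sup>2 = 1"
        by (simp add: power2_eq_square)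
      ultimately show ?thesis
        using \<open>d \<ge> 2\<close>
        by (intro exI[of _ "1::nat"] exI[of _ "3/5::complex"] exI[of _ "4/5::complex"]) auto
    next
      case False
      with n have "n dvd d" "n < d" "n > 0" using \<open>n \<le> d\<close> by auto
      \<comment> \<open>With opposite coefficients the zeros are the \<open>i\<close> whose power is
        1, that is, the power at \<open>q = 0\<close>; their number is
        \<open>gcd n d = n\<close>.\<close>
      define \<alpha> where "\<alpha> = complex_of_real (1 / sqrt 2)"
      have "\<alpha> \<noteq> 0" by (simp add: \<alpha>_def)
      then have "\<alpha> + (- \<alpha>) * root_of_unity d ^ (i * n) = 0 \<longleftrightarrow>
          root_of_unity d ^ (i * n) = root_of_unity d ^ (0 * n)" for i
        by (auto simp: algebra_simps)
      then have "card {i. i < d \<and> \<alpha> + (- \<alpha>) * root_of_unity d ^ (i * n) = 0} = n"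
        using card_root_of_unity_power_eq[of d n 0] \<open>n dvd d\<close> \<open>d \<ge> 2\<close>
        by (simp add: gcd_proj1_iff)
      moreover have "(cmod \<alpha>)\<^sup>2 + (cmod (- \<alpha>))\<^sup>2 = 1"
        by (simp add: \<alpha>_def norm_divide power_divide)
      ultimately show ?thesis
        using \<open>\<alpha> \<noteq> 0\<close> \<open>n < d\<close> \<open>n > 0\<close>
        by (intro exI[of _ n] exI[of _ \<alpha>] exI[of _ "- \<alpha>"]) simp
    qed
    then obtain k \<alpha> \<beta> where k: "0 < k" "k < d"
      and \<alpha>\<beta>: "\<alpha> \<noteq> 0" "\<beta> \<noteq> 0" "(cmod \<alpha>)\<^sup>2 + (cmod \<beta>)\<^sup>2 = 1"
      and card: "card {i. i < d \<and> \<alpha> + \<beta> * root_of_unity d ^ (i * k) = 0} = n"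
      by blast
    define \<psi> where "\<psi> = scl \<alpha> (b 0) + scl \<beta> (b k)"
    have "ip (a i) \<psi> = 0 \<longleftrightarrow> \<alpha> + \<beta> * root_of_unity d ^ (i * k) = 0" if "i < d" for i
    proof -
      have "ip (a i) \<psi> = (\<alpha> + \<beta> * root_of_unity d ^ (i * k)) / of_real (sqrt (real d))"
        using k that by (simp add: \<psi>_def ip_add_right ip_scale_right trans add_divide_distrib)
      then show ?thesis using \<open>d \<ge> 2\<close> by simp
    qed
    then have "{i. i < d \<and> ip (a i) \<psi> = 0} = {i. i < d \<and> \<alpha> + \<beta> * root_of_unity d ^ (i * k) = 0}"
      by blast
    then have "supp_size ip d a \<psi> = d - n"
      by (simp add: supp_size_eq_diff card)
    moreover have "is_state ip \<psi>" "supp_size ip d b \<psi> = 2"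
      using two_term_state[OF \<open>is_orthonormal_basis scl ip d b\<close> _ \<open>k < d\<close> _ \<alpha>\<beta>, of 0] k
      by (auto simp: \<psi>_def)
    \<comment> \<open>The diagram admits only positive support sizes, and \<open>n < d\<close> holds
      in both cases.\<close>
    moreover have "d - n \<ge> 1"
      using n \<open>n \<le> d\<close> \<open>d \<ge> 2\<close> by auto
    ultimately show "(d - n, 2) \<in> UNCD ip d a b"
      using \<open>d \<ge> 2\<close> by (auto simp: UNCD_def)
  }
qed

end
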